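(* The Grötzsch graph and the Petersen graph are each projective cores.
   Context: Graphs are finite, simple, undirected, loopless. The Grötzsch graph is the 11-vertex graph obtained from a 5-cycle $v_1\dots v_5$ by adding vertices $v_1',\dots,v_5'$, with $v_i'$ adjacent to the two cycle-neighbours of $v_i$, and a further vertex adjacent to all $v_i'$ (the Mycielskian of $C_5$). The Petersen graph is the standard 10-vertex 3-regular graph (Kneser graph $K(5,2)$). $H$ is a core if every homomorphism $H\to H$ is bijective. A polymorphism $f:V_H^m\to V_H$ is a homomorphism $H^m\to H$ (direct product); it is idempotent if $f(x,\dots,x)=x$. $H$ is projective if every idempotent polymorphism is a projection. *)

theory Defs
  imports "Graph_Theory.Pair_Digraph" "HOL-Library.FuncSet"
begin

text \<open>
  A finite simple undirected loopless graph is a \<^locale>\<open>pair_graph\<close>: an edge \<open>{u, v}\<close> is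
  represented by the two arcs \<open>(u, v)\<close> and \<open>(v, u)\<close>.
\<close>

definition graph_hom :: "('a \<Rightarrow> 'b) \<Rightarrow> 'a pair_pre_digraph \<Rightarrow> 'b pair_pre_digraph \<Rightarrow> bool" where
  "graph_hom f G H \<longleftrightarrow>
     f \<in> pverts G \<rightarrow> pverts H \<and> (\<forall>u v. (u, v) \<in> parcs G \<longrightarrow> (f u, f v) \<in> parcs H)"

definition is_core :: "'a pair_pre_digraph \<Rightarrow> bool" where
  "is_core H \<longleftrightarrow> (\<forall>f. graph_hom f H H \<longrightarrow> bij_betw f (pverts H) (pverts H))"

text \<open>The \<open>m\<close>-tuples of vertices are the extensional functions on \<open>{..<m}\<close>.\<close>

definition direct_power :: "'a pair_pre_digraph \<Rightarrow> nat \<Rightarrow> (nat \<Rightarrow> 'a) pair_pre_digraph" where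
  "direct_power H m =
     \<lparr> pverts = {..<m} \<rightarrow>\<^sub>E pverts H,
       parcs = {(x, y). x \<in> {..<m} \<rightarrow>\<^sub>E pverts H \<and> y \<in> {..<m} \<rightarrow>\<^sub>E pverts H \<and>
                        (\<forall>i<m. (x i, y i) \<in> parcs H)} \<rparr>"

definition polymorphism :: "'a pair_pre_digraph \<Rightarrow> nat \<Rightarrow> ((nat \<Rightarrow> 'a) \<Rightarrow> 'a) \<Rightarrow> bool" where
  "polymorphism H m f \<longleftrightarrow> graph_hom f (direct_power H m) H"

definition idempotent :: "'a pair_pre_digraph \<Rightarrow> nat \<Rightarrow> ((nat \<Rightarrow> 'a) \<Rightarrow> 'a) \<Rightarrow> bool" where
  "idempotent H m f \<longleftrightarrow> (\<forall>v\<in>pverts H. f (\<lambda>i\<in>{..<m}. v) = v)"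

definition is_projection :: "'a pair_pre_digraph \<Rightarrow> nat \<Rightarrow> ((nat \<Rightarrow> 'a) \<Rightarrow> 'a) \<Rightarrow> bool" where
  "is_projection H m f \<longleftrightarrow> (\<exists>i<m. \<forall>x\<in>pverts (direct_power H m). f x = x i)"

definition projective :: "'a pair_pre_digraph \<Rightarrow> bool" where
  "projective H \<longleftrightarrow>
     (\<forall>m\<ge>1. \<forall>f. polymorphism H m f \<and> idempotent H m f \<longrightarrow> is_projection H m f)"

definition cycle_graph :: "nat \<Rightarrow> nat pair_pre_digraph" where
  "cycle_graph n =
     \<lparr> pverts = {..<n},
       parcs = {(i, j). i < n \<and> j < n \<and> (j = Suc i mod n \<or> i = Suc j mod n)} \<rparr>"

datatype 'a mycielski_vertex = Orig 'a | Shadow 'a | Apex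

definition mycielskian :: "'a pair_pre_digraph \<Rightarrow> 'a mycielski_vertex pair_pre_digraph" where
  "mycielskian G =
     \<lparr> pverts = Orig ` pverts G \<union> Shadow ` pverts G \<union> {Apex},
       parcs = {(Orig u, Orig v) | u v. (u, v) \<in> parcs G} \<union>
               {(Shadow u, Orig v) | u v. (u, v) \<in> parcs G} \<union>
               {(Orig u, Shadow v) | u v. (u, v) \<in> parcs G} \<union>
               {(Shadow u, Apex) | u. u \<in> pverts G} \<union>
               {(Apex, Shadow u) | u. u \<in> pverts G} \<rparr>"

definition grotzsch_graph :: "nat mycielski_vertex pair_pre_digraph" where
  "grotzsch_graph = mycielskian (cycle_graph 5)"

definition kneser_graph :: "nat \<Rightarrow> nat \<Rightarrow> nat set pair_pre_digraph" where
  "kneser_graph n k =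
     \<lparr> pverts = {A. A \<subseteq> {..<n} \<and> card A = k},
       parcs = {(A, B). A \<subseteq> {..<n} \<and> card A = k \<and> B \<subseteq> {..<n} \<and> card B = k \<and> A \<inter> B = {}} \<rparr>"

definition petersen_graph :: "nat set pair_pre_digraph" where
  "petersen_graph = kneser_graph 5 2"

lemma pair_graph_cycle_graph:
  assumes "n \<ge> 2"
  shows "pair_graph (cycle_graph n)"
proof
  fix e assume "e \<in> parcs (cycle_graph n)"
  then show "fst e \<in> pverts (cycle_graph n)" "snd e \<in> pverts (cycle_graph n)"
    "fst e \<noteq> snd e"
    using assms by (auto simp: cycle_graph_def mod_Suc split: if_splits)
next
  show "finite (pverts (cycle_graph n))"
    by (simp add: cycle_graph_def)
  show "finite (parcs (cycle_graph n))"
    by (rule finite_subset[of _ "{..<n} \<times> {..<n}"]) (auto simp: cycle_graph_def)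
  show "symmetric (with_proj (cycle_graph n))"
    by (auto simp: symmetric_def sym_def cycle_graph_def arcs_ends_def arc_to_ends_def)
qed

lemma pair_graph_mycielskian:
  assumes "pair_graph G"
  shows "pair_graph (mycielskian G)"
proof -
  interpret pair_graph G by fact
  have arcs: "u \<in> pverts G" "v \<in> pverts G" "u \<noteq> v" "(v, u) \<in> parcs G"
    if "(u, v) \<in> parcs G" for u v
    using that in_arcsD1 in_arcsD2 no_loops' arcs_symmetric by blast+
  let ?V = "Orig ` pverts G \<union> Shadow ` pverts G \<union> {Apex}"
  have fin: "finite ?V" by simp
  have sub: "parcs (mycielskian G) \<subseteq> ?V \<times> ?V"
    using arcs(1,2) by (auto simp: mycielskian_def)
  show ?thesis
  proof
    fix e assume "e \<in> parcs (mycielskian G)"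
    then show "fst e \<in> pverts (mycielskian G)" "snd e \<in> pverts (mycielskian G)"
      "fst e \<noteq> snd e"
      using arcs(1-3) by (auto simp: mycielskian_def)
  next
    show "finite (pverts (mycielskian G))"
      using fin by (simp add: mycielskian_def)
    show "finite (parcs (mycielskian G))"
      using finite_subset[OF sub] fin by blast
    show "symmetric (with_proj (mycielskian G))"
      using arcs(4)
      by (auto simp: symmetric_def sym_def mycielskian_def arcs_ends_def arc_to_ends_def)
  qed
qed

lemma pair_graph_kneser_graph:
  assumes "k \<ge> 1"
  shows "pair_graph (kneser_graph n k)"
proof
  fix e assume "e \<in> parcs (kneser_graph n k)"
  then obtain A B where e: "e = (A, B)" "A \<subseteq> {..<n}" "card A = k" "B \<subseteq> {..<n}" "card B = k"
      "A \<inter> B = {}"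
    unfolding kneser_graph_def by auto
  then show "fst e \<in> pverts (kneser_graph n k)" "snd e \<in> pverts (kneser_graph n k)"
    by (simp_all add: kneser_graph_def)
  show "fst e \<noteq> snd e"
  proof
    assume "fst e = snd e"
    with e have "A = {}" by simp
    with e(3) assms show False by simp
  qed
next
  have "pverts (kneser_graph n k) \<subseteq> Pow {..<n}"
    unfolding kneser_graph_def by auto
  then show "finite (pverts (kneser_graph n k))"
    by (rule finite_subset) simp
  have "parcs (kneser_graph n k) \<subseteq> Pow {..<n} \<times> Pow {..<n}"
    unfolding kneser_graph_def by auto
  then show "finite (parcs (kneser_graph n k))"
    by (rule finite_subset) simp
  show "symmetric (with_proj (kneser_graph n k))"
    by (auto simp: symmetric_def sym_def kneser_graph_def arcs_ends_def arc_to_ends_def)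
qed

lemma pair_graph_grotzsch_graph: "pair_graph grotzsch_graph"
  unfolding grotzsch_graph_def by (intro pair_graph_mycielskian pair_graph_cycle_graph) simp

lemma pair_graph_petersen_graph: "pair_graph petersen_graph"
  unfolding petersen_graph_def by (intro pair_graph_kneser_graph) simp

lemma card_pverts_grotzsch_graph: "card (pverts grotzsch_graph) = 11"
proof -
  have "card (Orig ` {..<5::nat} \<union> Shadow ` {..<5} \<union> {Apex}) = 5 + 5 + 1"
    by (subst card_Un_disjoint; (subst card_Un_disjoint)?)
      (auto simp: card_image inj_on_def)
  then show ?thesis
    by (simp add: grotzsch_graph_def mycielskian_def cycle_graph_def)
qed

lemma card_pverts_petersen_graph: "card (pverts petersen_graph) = 10"
  using n_subsets[of "{..<5::nat}" 2]
  by (simp add: petersen_graph_def kneser_graph_def choose_two)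

end

theory Submission
  imports Defs
begin

text \<open>
  Both graphs are triangle-free, any two nonadjacent vertices have a common neighbour, and no
  neighbourhood contains another. Such a graph is a core: if an endomorphism identified \<open>a\<close> and
  \<open>b\<close>, a neighbour \<open>c\<close> of \<open>a\<close> but not of \<open>b\<close> and a common neighbour of \<open>b\<close> and \<open>c\<close> would produce
  a triangle.

  For a binary idempotent polymorphism \<open>f\<close>, arc consistency excludes all values of \<open>f (a, b)\<close>
  except \<open>a\<close> and \<open>b\<close>; the choice between the two coordinates then propagates along arcs to all
  pairs. For arity at least three, identifying two coordinates gives a projection by induction.
  If for some pair it projects to a third coordinate, then \<open>f\<close> itself is that projection.
  Otherwise \<open>f\<close> behaves like a majority operation, and on a triple \<open>(a, b, c)\<close> its value must be
  adjacent to every common neighbour of two of the entries; a triple for which this is impossible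
  finishes the proof.
\<close>

section \<open>Maximal triangle-free graphs\<close>

text \<open>Given triangle-freeness, \<open>common_nbr\<close> says that any added edge would close
  a triangle; its case \<open>u = v\<close> gives every vertex a neighbour. By
  \<open>nbrs_incomparable\<close> two vertices can be identified from a single inclusion of
  neighbourhoods.\<close>

locale maximal_triangle_free = pair_graph H for H :: "'a pair_pre_digraph" +
  assumes triangle_free: "(u, v) \<in> parcs H \<Longrightarrow> (v, w) \<in> parcs H \<Longrightarrow> (w, u) \<notin> parcs H"
    and common_nbr: "\<lbrakk>u \<in> pverts H; v \<in> pverts H; (u, v) \<notin> parcs H\<rbrakk>
      \<Longrightarrow> \<exists>w. (u, w) \<in> parcs H \<and> (v, w) \<in> parcs H"
    and nbrs_incomparable: "\<lbrakk>u \<in> pverts H; v \<in> pverts H;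
      \<And>w. (u, w) \<in> parcs H \<Longrightarrow> (v, w) \<in> parcs H\<rbrakk> \<Longrightarrow> u = v"
begin

lemma arcs_sym: "(u, v) \<in> parcs H \<Longrightarrow> (v, u) \<in> parcs H"
  using arcs_symmetric by blast

lemma arc_vertsD: "(u, v) \<in> parcs H \<Longrightarrow> u \<in> pverts H \<and> v \<in> pverts H"
  using in_arcsD1 in_arcsD2 by blast

lemma loopless: "(u, u) \<notin> parcs H"
  using triangle_free by blast

lemma nbr_exists: "u \<in> pverts H \<Longrightarrow> \<exists>v. (u, v) \<in> parcs H"
  using common_nbr[of u u] loopless by blast

lemma is_core: "is_core H"
  unfolding is_core_def
proof (intro allI impI)
  fix f assume f: "graph_hom f H H"
  then have hom: "(f u, f v) \<in> parcs H" if "(u, v) \<in> parcs H" for u v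
    using that unfolding graph_hom_def by blast
  have "inj_on f (pverts H)"
  proof (rule inj_onI, rule ccontr)
    fix a b assume ab: "a \<in> pverts H" "b \<in> pverts H" "f a = f b" "a \<noteq> b"
    then obtain c where c: "(a, c) \<in> parcs H" "(b, c) \<notin> parcs H"
      using nbrs_incomparable by blast
    then obtain d where "(b, d) \<in> parcs H" "(c, d) \<in> parcs H"
      using common_nbr ab arc_vertsD by blast
    then show False
      using triangle_free[of "f a" "f c" "f d"] hom c ab(3) arcs_sym by metis
  qed
  moreover have "f ` pverts H \<subseteq> pverts H"
    using f unfolding graph_hom_def by blast
  ultimately show "bij_betw f (pverts H) (pverts H)"
    using endo_inj_surj pair_finite_verts unfolding bij_betw_def by blast
qed

end

section \<open>Mycielskians of maximal triangle-free graphs\<close>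

lemma mycielskian_simps [simp]:
  "(Orig u, Orig v) \<in> parcs (mycielskian G) \<longleftrightarrow> (u, v) \<in> parcs G"
  "(Orig u, Shadow v) \<in> parcs (mycielskian G) \<longleftrightarrow> (u, v) \<in> parcs G"
  "(Shadow u, Orig v) \<in> parcs (mycielskian G) \<longleftrightarrow> (u, v) \<in> parcs G"
  "(Shadow u, Apex) \<in> parcs (mycielskian G) \<longleftrightarrow> u \<in> pverts G"
  "(Apex, Shadow u) \<in> parcs (mycielskian G) \<longleftrightarrow> u \<in> pverts G"
  "(Shadow u, Shadow v) \<notin> parcs (mycielskian G)"
  "(Orig u, Apex) \<notin> parcs (mycielskian G)"
  "(Apex, Orig u) \<notin> parcs (mycielskian G)"
  "(Apex, Apex) \<notin> parcs (mycielskian G)"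
  "Orig u \<in> pverts (mycielskian G) \<longleftrightarrow> u \<in> pverts G"
  "Shadow u \<in> pverts (mycielskian G) \<longleftrightarrow> u \<in> pverts G"
  "Apex \<in> pverts (mycielskian G)"
  by (auto simp: mycielskian_def)

text \<open>Vertices over nonadjacent indices share an \<open>Orig\<close> neighbour coming from
  \<open>G\<close>, two shadows share \<open>Apex\<close>, and \<open>Orig x\<close> shares with
  \<open>Apex\<close> the shadow of a neighbour of \<open>x\<close>. Neighbourhoods stay
  incomparable: only \<open>Orig\<close> vertices see both originals and shadows, only shadows see
  \<open>Apex\<close>, only \<open>Apex\<close> sees all shadows, and within one kind the property
  is inherited from \<open>G\<close>.\<close>

lemma maximal_triangle_free_mycielskian:
  assumes "maximal_triangle_free G" "pverts G \<noteq> {}"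
  shows "maximal_triangle_free (mycielskian G)"
proof -
  interpret maximal_triangle_free G by fact
  show ?thesis
  proof (intro maximal_triangle_free.intro maximal_triangle_free_axioms.intro)
    show "pair_graph (mycielskian G)"
      by (rule pair_graph_mycielskian) unfold_locales
  next
    fix u v w
    assume "(u, v) \<in> parcs (mycielskian G)" "(v, w) \<in> parcs (mycielskian G)"
    then show "(w, u) \<notin> parcs (mycielskian G)"
      by (cases u; cases v; cases w) (auto dest: triangle_free)
  next
    fix u v
    assume uv: "u \<in> pverts (mycielskian G)" "v \<in> pverts (mycielskian G)"
      "(u, v) \<notin> parcs (mycielskian G)"
    have orig: "\<exists>w. (u, w) \<in> parcs (mycielskian G) \<and> (v, w) \<in> parcs (mycielskian G)"
      if "u = Orig x \<or> u = Shadow x" "v = Orig y \<or> v = Shadow y"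
        "x \<in> pverts G" "y \<in> pverts G" "(x, y) \<notin> parcs G" for x y
      using common_nbr[of x y] that by (metis mycielskian_simps(1,3))
    have shadow: "\<exists>w. (Orig x, w) \<in> parcs (mycielskian G) \<and> (Apex, w) \<in> parcs (mycielskian G)"
      if "x \<in> pverts G" for x
      using nbr_exists[OF that] arc_vertsD by (metis mycielskian_simps(2,5))
    show "\<exists>w. (u, w) \<in> parcs (mycielskian G) \<and> (v, w) \<in> parcs (mycielskian G)"
    proof (cases u)
      case (Orig x)
      then show ?thesis using uv orig[of x] shadow[of x] by (cases v) auto
    next
      case (Shadow x)
      then show ?thesis
        using uv orig[of x] mycielskian_simps(4) by (cases v) (auto intro!: exI[of _ Apex])
    next
      case Apex
      \<comment> \<open>The pair of \<open>Apex\<close> with itself requires a neighbour of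
        \<open>Apex\<close>; nonemptiness of \<open>G\<close> provides one.\<close>
      obtain x where "x \<in> pverts G" using assms(2) by blast
      then have apex: "\<exists>w. (Apex, w) \<in> parcs (mycielskian G)"
        by (auto intro!: exI[of _ "Shadow x"])
      show ?thesis
        using uv shadow apex Apex by (cases v) auto
    qed
  next
    fix u v
    assume uv: "u \<in> pverts (mycielskian G)" "v \<in> pverts (mycielskian G)"
      and sub: "\<And>w. (u, w) \<in> parcs (mycielskian G) \<Longrightarrow> (v, w) \<in> parcs (mycielskian G)"
    show "u = v"
    proof (cases u)
      case (Orig x)
      then obtain y where y: "(x, y) \<in> parcs G"
        using uv(1) nbr_exists by auto
      then obtain z where z: "v = Orig z"
        using sub[of "Orig y"] sub[of "Shadow y"] Orig by (cases v) auto
      have "(z, w) \<in> parcs G" if "(x, w) \<in> parcs G" for w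
        using sub[of "Orig w"] that Orig z by simp
      then show ?thesis
        using nbrs_incomparable[of x z] uv Orig z by simp
    next
      case (Shadow x)
      then obtain z where z: "v = Shadow z"
        using sub[of Apex] uv by (cases v) auto
      have "(z, w) \<in> parcs G" if "(x, w) \<in> parcs G" for w
        using sub[of "Orig w"] that Shadow z by simp
      then show ?thesis
        using nbrs_incomparable[of x z] uv Shadow z by simp
    next
      case Apex
      then show ?thesis
        using sub[of "Shadow z" for z] uv(2) loopless by (cases v) auto
    qed
  qed
qed

section \<open>Binary idempotent polymorphisms\<close>

text \<open>Arc consistency: a derivation of \<open>refuted H a b c\<close> shows that no binary idempotent
  polymorphism sends \<open>(a, b)\<close> to \<open>c\<close>, because \<open>(p, q)\<close> would be sent to a neighbour of \<open>c\<close>.\<close>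

inductive refuted :: "'a pair_pre_digraph \<Rightarrow> 'a \<Rightarrow> 'a \<Rightarrow> 'a \<Rightarrow> bool" for H where
  diag: "c \<noteq> a \<Longrightarrow> refuted H a a c"
| step: "\<lbrakk>(a, p) \<in> parcs H; (b, q) \<in> parcs H; \<And>d. (c, d) \<in> parcs H \<Longrightarrow> refuted H p q d\<rbrakk>
    \<Longrightarrow> refuted H a b c"

text \<open>Derivable form of conservativity at one pair. It concerns the graph alone and can be
  established pair by pair before any polymorphism is fixed.\<close>

definition settled :: "'a pair_pre_digraph \<Rightarrow> 'a \<Rightarrow> 'a \<Rightarrow> bool" where
  "settled H a b \<longleftrightarrow> (\<forall>c\<in>pverts H. c \<noteq> a \<longrightarrow> c \<noteq> b \<longrightarrow> refuted H a b c)"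

lemma refuted_swap: "refuted H a b c \<Longrightarrow> refuted H b a c"
  by (induction rule: refuted.induct) (auto intro: refuted.intros)

lemma settled_swap: "settled H a b \<Longrightarrow> settled H b a"
  unfolding settled_def using refuted_swap by metis

lemma settled_refl: "settled H a a"
  unfolding settled_def by (auto intro: refuted.diag)

context maximal_triangle_free
begin

text \<open>The value at \<open>(p, q)\<close> can only be \<open>p\<close> or \<open>q\<close> and
  has to be adjacent to the value at \<open>(a, b)\<close>. Most refutations in the two concrete
  graphs are instances of this rule.\<close>

lemma refuted_settled:
  assumes "settled H p q" "(a, p) \<in> parcs H" "(b, q) \<in> parcs H"
    "(p, c) \<notin> parcs H" "(q, c) \<notin> parcs H"
  shows "refuted H a b c"
proof (rule refuted.step)
  fix d assume d: "(c, d) \<in> parcs H"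
  then have "d \<noteq> p" "d \<noteq> q"
    using assms(4,5) arcs_sym[OF d] by auto
  then show "refuted H p q d"
    using assms(1) arc_vertsD[OF d] unfolding settled_def by simp
qed fact+

text \<open>The case \<open>p = q = u\<close> of the previous rule, where idempotence fixes the
  value.\<close>

lemma refuted_common_nbr:
  assumes "(a, u) \<in> parcs H" "(b, u) \<in> parcs H" "(u, c) \<notin> parcs H"
  shows "refuted H a b c"
  using refuted_settled[OF settled_refl assms(1,2)] assms(3) by simp

lemma settled_two_common_nbrs:
  assumes "(a, u) \<in> parcs H" "(b, u) \<in> parcs H" "(a, u') \<in> parcs H" "(b, u') \<in> parcs H"
    and "\<And>c. (u, c) \<in> parcs H \<Longrightarrow> (u', c) \<in> parcs H \<Longrightarrow> c = a \<or> c = b"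
  shows "settled H a b"
  unfolding settled_def using assms refuted_common_nbr[of a _ b] by metis

lemma refuted_sound:
  assumes "refuted H a b c"
    and idem: "\<And>v. v \<in> pverts H \<Longrightarrow> g v v = v"
    and hom: "\<And>u v u' v'. (u, u') \<in> parcs H \<Longrightarrow> (v, v') \<in> parcs H \<Longrightarrow> (g u v, g u' v') \<in> parcs H"
    and "a \<in> pverts H" "b \<in> pverts H"
  shows "g a b \<noteq> c"
  using assms(1,4,5)
proof (induction rule: refuted.induct)
  case (diag c a)
  then show ?case using idem by auto
next
  case (step a p b q c)
  then show ?case using hom[of a p b q] arc_vertsD by blast
qed

lemma binary_first_projection:
  assumes cons: "\<And>u v. u \<in> pverts H \<Longrightarrow> v \<in> pverts H \<Longrightarrow> g u v = u \<or> g u v = v"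
    and hom: "\<And>u v u' v'. (u, u') \<in> parcs H \<Longrightarrow> (v, v') \<in> parcs H \<Longrightarrow> (g u v, g u' v') \<in> parcs H"
    and "(a, b) \<in> parcs H" "g a b = a" "c \<in> pverts H" "d \<in> pverts H"
  shows "g c d = c"
proof -
  \<comment> \<open>\<open>g u' v'\<close> is adjacent to \<open>g u v = u\<close>; since
    \<open>v'\<close> is not, conservativity leaves only \<open>u'\<close>.\<close>
  have propagate: "g u' v' = u'"
    if "g u v = u" "(u, u') \<in> parcs H" "(v, v') \<in> parcs H" "(u, v') \<notin> parcs H" for u v u' v'
    using cons[of u' v'] hom[OF that(2,3)] that arc_vertsD by metis
  \<comment> \<open>Triangle-freeness makes the ends of the walk \<open>u, v, w\<close> nonadjacent,
    so \<open>propagate\<close> moves the choice from the arc \<open>(u, v)\<close> to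
    \<open>(v, w)\<close>.\<close>
  have along: "g v w = v" if "(u, v) \<in> parcs H" "g u v = u" "(v, w) \<in> parcs H" for u v w
    using propagate[of u v v w] that triangle_free[of u v w] arcs_sym[of u w] by blast
  \<comment> \<open>\<open>Q v\<close>: on all arcs leaving \<open>v\<close>, \<open>g\<close> takes
    the first coordinate. The property passes to neighbours, and by \<open>common_nbr\<close> every
    vertex lies within two steps of \<open>b\<close>.\<close>
  define Q where "Q v \<longleftrightarrow> (\<forall>w. (v, w) \<in> parcs H \<longrightarrow> g v w = v)" for v
  have Qb: "Q b"
    unfolding Q_def using along assms(3,4) by blast
  have Q_nbr: "Q w" if "Q v" "(v, w) \<in> parcs H" for v w
    using that along unfolding Q_def by blast
  have Q: "Q v" if "v \<in> pverts H" for v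
    using Q_nbr[of b] Q_nbr[of _ v] Qb common_nbr[of b v] that arc_vertsD[OF assms(3)]
      arcs_sym[of v] by blast
  show ?thesis
  proof (cases "c = d \<or> (c, d) \<in> parcs H")
    case True
    then show ?thesis using cons[of c d] Q[of c] assms(5,6) unfolding Q_def by auto
  next
    case False
    \<comment> \<open>The value at the arc \<open>(u, v)\<close> is known to be \<open>u\<close>,
      and \<open>u\<close> is not adjacent to \<open>d\<close>; hence \<open>propagate\<close>
      carries the choice to \<open>(c, d)\<close>.\<close>
    then obtain u where u: "(c, u) \<in> parcs H" "(d, u) \<notin> parcs H"
      using nbrs_incomparable assms(5,6) by blast
    then obtain v where v: "(u, v) \<in> parcs H" "(d, v) \<in> parcs H"
      using common_nbr[of d u] assms(6) arc_vertsD by blast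
    then have "g u v = u"
      using Q[of u] arc_vertsD unfolding Q_def by blast
    then show ?thesis
      using propagate[of u v c d] u v arcs_sym[of c u] arcs_sym[of d v] arcs_sym[of u d] by blast
  qed
qed

lemma binary_projection:
  assumes settled: "\<And>u v. u \<in> pverts H \<Longrightarrow> v \<in> pverts H \<Longrightarrow> settled H u v"
    and idem: "\<And>v. v \<in> pverts H \<Longrightarrow> g v v = v"
    and hom: "\<And>u v u' v'. (u, u') \<in> parcs H \<Longrightarrow> (v, v') \<in> parcs H \<Longrightarrow> (g u v, g u' v') \<in> parcs H"
  shows "(\<forall>u\<in>pverts H. \<forall>v\<in>pverts H. g u v = u) \<or> (\<forall>u\<in>pverts H. \<forall>v\<in>pverts H. g u v = v)"
proof (cases "pverts H = {}")
  case False
  have cons: "g u v = u \<or> g u v = v" if "u \<in> pverts H" "v \<in> pverts H" for u v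
  proof -
    obtain u' v' where "(u, u') \<in> parcs H" "(v, v') \<in> parcs H"
      using nbr_exists \<open>u \<in> _\<close> \<open>v \<in> _\<close> by blast
    then have "g u v \<in> pverts H" using hom arc_vertsD by blast
    then show ?thesis
      using refuted_sound[of u v "g u v" g] idem hom settled[OF that] that
      unfolding settled_def by blast
  qed
  obtain a b where ab: "(a, b) \<in> parcs H"
    using False nbr_exists by blast
  then consider "g a b = a" | "g a b = b"
    using cons arc_vertsD by blast
  then show ?thesis
  proof cases
    case 1
    then show ?thesis using binary_first_projection[of g, OF cons hom ab] by blast
  next
    case 2
    \<comment> \<open>Exchanging the arguments of \<open>g\<close> turns the second coordinate into
      the first, now at the arc \<open>(b, a)\<close>.\<close>
    then show ?thesis
      using binary_first_projection[of "\<lambda>x y. g y x" b a] cons hom arcs_sym[OF ab] by blast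
  qed
qed simp

end

section \<open>From binary to arbitrary arity\<close>

abbreviation tuples :: "'a pair_pre_digraph \<Rightarrow> nat \<Rightarrow> (nat \<Rightarrow> 'a) set" where
  "tuples H m \<equiv> {..<m} \<rightarrow>\<^sub>E pverts H"

lemma polymorphism_closed:
  "polymorphism H m f \<Longrightarrow> x \<in> tuples H m \<Longrightarrow> f x \<in> pverts H"
  unfolding polymorphism_def graph_hom_def direct_power_def by auto

lemma polymorphism_arc:
  "\<lbrakk>polymorphism H m f; x \<in> tuples H m; y \<in> tuples H m; \<And>i. i < m \<Longrightarrow> (x i, y i) \<in> parcs H\<rbrakk>
    \<Longrightarrow> (f x, f y) \<in> parcs H"
  unfolding polymorphism_def graph_hom_def direct_power_def by auto

lemma polymorphismI:
  assumes "\<And>x. x \<in> tuples H m \<Longrightarrow> f x \<in> pverts H"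
    and "\<And>x y. \<lbrakk>x \<in> tuples H m; y \<in> tuples H m; \<And>i. i < m \<Longrightarrow> (x i, y i) \<in> parcs H\<rbrakk>
      \<Longrightarrow> (f x, f y) \<in> parcs H"
  shows "polymorphism H m f"
  using assms unfolding polymorphism_def graph_hom_def direct_power_def by auto

lemma is_projection_iff:
  "is_projection H m f \<longleftrightarrow> (\<exists>i<m. \<forall>x\<in>tuples H m. f x = x i)"
  unfolding is_projection_def direct_power_def by simp

text \<open>Duplicating one entry of a shorter tuple turns \<open>f\<close> into an
  \<open>n\<close>-ary operation. As that operation is a projection, it determines \<open>f\<close>
  on the tuples with \<open>x i = x j\<close>.\<close>

lemma projection_of_minor:
  assumes f: "polymorphism H (Suc n) f" "idempotent H (Suc n) f" and ij: "i < j" "j < Suc n"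
    and minors: "\<And>g. polymorphism H n g \<Longrightarrow> idempotent H n g \<Longrightarrow> is_projection H n g"
  shows "\<exists>p<Suc n. \<forall>x\<in>tuples H (Suc n). x i = x j \<longrightarrow> f x = x p"
proof -
  \<comment> \<open>\<open>\<sigma>\<close> collapses the \<open>n + 1\<close> indices onto
    \<open>n\<close> by merging \<open>j\<close> into \<open>i\<close> and closing the gap;
    \<open>\<tau>\<close> is its section skipping \<open>j\<close>. So
    \<open>\<tau> (\<sigma> k)\<close> is \<open>k\<close>, except that \<open>j\<close> goes to
    \<open>i\<close>.\<close>
  define \<sigma> where "\<sigma> k = (if k < j then k else if k = j then i else k - 1)" for k
  define \<tau> where "\<tau> l = (if l < j then l else Suc l)" for l
  define blow where "blow x = (\<lambda>k\<in>{..<Suc n}. x (\<sigma> k))" for x :: "nat \<Rightarrow> 'a"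
  have \<sigma>: "\<sigma> k < n" if "k < Suc n" for k
    using that ij unfolding \<sigma>_def by auto
  have \<tau>: "\<tau> l < Suc n" if "l < n" for l
    using that unfolding \<tau>_def by auto
  have blow: "blow x \<in> tuples H (Suc n)" if "x \<in> tuples H n" for x
    using that \<sigma> unfolding blow_def by (auto simp: PiE_mem)
  have "polymorphism H n (f \<circ> blow)"
  proof (rule polymorphismI)
    fix x y assume xy: "x \<in> tuples H n" "y \<in> tuples H n" "\<And>k. k < n \<Longrightarrow> (x k, y k) \<in> parcs H"
    have "(blow x k, blow y k) \<in> parcs H" if "k < Suc n" for k
      using xy(3) \<sigma>[OF that] that unfolding blow_def by simp
    then show "((f \<circ> blow) x, (f \<circ> blow) y) \<in> parcs H"
      using polymorphism_arc[OF f(1)] blow xy by simp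
  qed (use polymorphism_closed[OF f(1)] blow in auto)
  moreover have "idempotent H n (f \<circ> blow)"
    unfolding idempotent_def
  proof
    fix v assume "v \<in> pverts H"
    moreover have "blow (\<lambda>k\<in>{..<n}. v) = (\<lambda>k\<in>{..<Suc n}. v)"
      using \<sigma> unfolding blow_def by (auto intro!: restrict_ext)
    ultimately show "(f \<circ> blow) (\<lambda>k\<in>{..<n}. v) = v"
      using f(2) unfolding idempotent_def by simp
  qed
  ultimately have "is_projection H n (f \<circ> blow)"
    by (rule minors)
  then obtain p where p: "p < n" "\<And>x. x \<in> tuples H n \<Longrightarrow> f (blow x) = x p"
    unfolding is_projection_iff by auto
  have "f x = x (\<tau> p)" if x: "x \<in> tuples H (Suc n)" "x i = x j" for x
  proof -
    define y where "y = (\<lambda>l\<in>{..<n}. x (\<tau> l))"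
    have y: "y \<in> tuples H n"
      using x(1) \<tau> unfolding y_def by (auto simp: PiE_mem)
    have "blow y = x"
    proof
      fix k
      show "blow y k = x k"
      proof (cases "k < Suc n")
        case True
        then have "blow y k = x (\<tau> (\<sigma> k))"
          using \<sigma> unfolding blow_def y_def by simp
        also have "\<dots> = x k"
          using ij x(2) True unfolding \<tau>_def \<sigma>_def by auto
        finally show ?thesis .
      next
        case False
        then show ?thesis using PiE_arb[OF x(1), of k] unfolding blow_def by simp
      qed
    qed
    then have "f x = y p" using p(2)[OF y] by simp
    also have "\<dots> = x (\<tau> p)" using p(1) unfolding y_def by simp
    finally show ?thesis .
  qed
  with \<tau>[OF p(1)] show ?thesis by (intro exI[of _ "\<tau> p"]) simp
qed

context maximal_triangle_free
begin

text \<open>As every vertex has a neighbour, coordinates without a prescribed value can be filled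
  arbitrarily. Three prescriptions serve for two coordinates to be compared and one to be read
  off.\<close>

lemma adjacent_tuple:
  assumes x: "x \<in> tuples H m"
    and "i < m" "j < m" "p < m" "p \<noteq> i" "p \<noteq> j" "i \<noteq> j"
    and nbrs: "(x i, u) \<in> parcs H" "(x j, v) \<in> parcs H" "(x p, w) \<in> parcs H"
  shows "\<exists>y\<in>tuples H m. (\<forall>k<m. (x k, y k) \<in> parcs H) \<and> y i = u \<and> y j = v \<and> y p = w"
proof -
  define nb where "nb k = (SOME z. (x k, z) \<in> parcs H)" for k
  have nb: "(x k, nb k) \<in> parcs H" if "k < m" for k
    unfolding nb_def using that PiE_mem[OF x, of k] someI_ex[OF nbr_exists[of "x k"]] by simp
  define y where "y = (\<lambda>k\<in>{..<m}. (nb(i := u, j := v, p := w)) k)"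
  have arcs: "(x k, y k) \<in> parcs H" if "k < m" for k
    using that nb[OF that] nbrs unfolding y_def by simp
  have "y k \<in> pverts H" if "k < m" for k
    using arc_vertsD[OF arcs[OF that]] by simp
  then have "y \<in> tuples H m"
    unfolding PiE_iff by (simp add: y_def)
  moreover have "y i = u" "y j = v" "y p = w"
    using assms(2-7) unfolding y_def by simp_all
  ultimately show ?thesis
    using arcs by (intro bexI[of _ y]) simp_all
qed

text \<open>Otherwise the neighbourhoods of \<open>u\<close> and \<open>v\<close> are completely
  joined. Incomparability then makes \<open>u\<close> and \<open>v\<close> each other's only
  neighbours, and a third vertex has no common neighbour with \<open>u\<close>.\<close>

lemma arc_nonadjacent_nbrs:
  assumes "(u, v) \<in> parcs H" "\<exists>w\<in>pverts H. w \<noteq> u \<and> w \<noteq> v"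
  shows "\<exists>u' v'. (u, u') \<in> parcs H \<and> (v, v') \<in> parcs H \<and> (u', v') \<notin> parcs H"
proof (rule ccontr)
  assume contra: "\<not> ?thesis"
  have v: "v' = u" if "(v, v') \<in> parcs H" for v'
  proof (rule sym, rule nbrs_incomparable)
    show "(v', w) \<in> parcs H" if "(u, w) \<in> parcs H" for w
      using contra that \<open>(v, v') \<in> parcs H\<close> arcs_sym[of w v'] by blast
  qed (use arc_vertsD[OF that] arc_vertsD[OF assms(1)] in simp_all)
  have u: "u' = v" if "(u, u') \<in> parcs H" for u'
  proof (rule sym, rule nbrs_incomparable)
    show "(u', w) \<in> parcs H" if "(v, w) \<in> parcs H" for w
      using contra that \<open>(u, u') \<in> parcs H\<close> by blast
  qed (use arc_vertsD[OF that] arc_vertsD[OF assms(1)] in simp_all)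
  obtain w where w: "w \<in> pverts H" "w \<noteq> u" "w \<noteq> v"
    using assms(2) by blast
  then obtain z where "(u, z) \<in> parcs H" "(w, z) \<in> parcs H"
    using common_nbr[of u w] u[of w] arc_vertsD[OF assms(1)] by blast
  then show False
    using u[of z] v[of w] arcs_sym[of w z] w(2) by blast
qed

text \<open>By maximality, a tuple whose coordinates \<open>i\<close> and \<open>j\<close> are nonadjacent has a neighbour
  agreeing in these two coordinates; incomparability of neighbourhoods then determines the value.\<close>

lemma semiprojection_is_projection:
  assumes f: "polymorphism H m f" and ij: "i < m" "j < m" "p < m" "p \<noteq> i" "p \<noteq> j" "i \<noteq> j"
    and semi: "\<And>x. x \<in> tuples H m \<Longrightarrow> x i = x j \<Longrightarrow> f x = x p"
    and three: "\<And>u v. \<exists>w\<in>pverts H. w \<noteq> u \<and> w \<noteq> v"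
    and x: "x \<in> tuples H m"
  shows "f x = x p"
proof -
  have lift: "f x = x p"
    if x: "x \<in> tuples H m" and uv: "(x i, u) \<in> parcs H" "(x j, v) \<in> parcs H"
      and good: "\<And>y. y \<in> tuples H m \<Longrightarrow> y i = u \<Longrightarrow> y j = v \<Longrightarrow> f y = y p" for x u v
  proof -
    have "x p = f x"
    proof (rule nbrs_incomparable)
      fix w assume "(x p, w) \<in> parcs H"
      from adjacent_tuple[OF x ij uv this] good show "(f x, w) \<in> parcs H"
        using polymorphism_arc[OF f x] by metis
    qed (use x ij polymorphism_closed[OF f] in \<open>auto simp: PiE_mem\<close>)
    then show ?thesis ..
  qed
  have nonadj: "f x = x p" if x: "x \<in> tuples H m" "(x i, x j) \<notin> parcs H" for x
  proof -
    obtain u where "(x i, u) \<in> parcs H" "(x j, u) \<in> parcs H"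
      using common_nbr[of "x i" "x j"] x ij(1,2) by (auto simp: PiE_mem)
    then show ?thesis
      using lift[OF x(1)] semi by metis
  qed
  show ?thesis
  proof (cases "(x i, x j) \<in> parcs H")
    case True
    \<comment> \<open>One step leads from adjacent entries at \<open>i\<close> and \<open>j\<close>
      to nonadjacent ones, where \<open>nonadj\<close> gives the value.\<close>
    then obtain u v where "(x i, u) \<in> parcs H" "(x j, v) \<in> parcs H" "(u, v) \<notin> parcs H"
      using arc_nonadjacent_nbrs three by meson
    then show ?thesis
      using lift[OF x] nonadj by metis
  qed (use nonadj x in blast)
qed

text \<open>By \<open>empty\<close> no vertex can be a majority value at \<open>(a, b, c)\<close>.
  The induction starts at arity one, where idempotence decides; arity two rests on
  \<open>settled\<close>, and higher arities on minors.\<close>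

theorem projective:
  assumes settled: "\<And>u v. u \<in> pverts H \<Longrightarrow> v \<in> pverts H \<Longrightarrow> settled H u v"
    and ab: "(a, u) \<in> parcs H" "(b, u) \<in> parcs H"
    and ac: "(a, v) \<in> parcs H" "(c, v) \<in> parcs H"
    and bc: "(b, w) \<in> parcs H" "(c, w) \<in> parcs H"
    and empty: "\<And>z. \<not> ((u, z) \<in> parcs H \<and> (v, z) \<in> parcs H \<and> (w, z) \<in> parcs H)"
  shows "projective H"
proof -
  have no_median: "\<not> ((z, u) \<in> parcs H \<and> (z, v) \<in> parcs H \<and> (z, w) \<in> parcs H)" for z
    using empty[of z] arcs_sym[of z] by blast
  have verts: "a \<in> pverts H" "b \<in> pverts H" "c \<in> pverts H"
    using ab ac arc_vertsD by auto
  \<comment> \<open>If two of the three coincided, that vertex would be adjacent to all of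
    \<open>u\<close>, \<open>v\<close>, \<open>w\<close>.\<close>
  have "a \<noteq> b" "a \<noteq> c" "b \<noteq> c"
    using no_median ab ac bc by auto
  then have "a \<notin> {s, t} \<or> b \<notin> {s, t} \<or> c \<notin> {s, t}" for s t
    by auto
  then have three: "\<exists>z\<in>pverts H. z \<noteq> s \<and> z \<noteq> t" for s t
    using verts by blast
  have "is_projection H (Suc n) f"
    if "polymorphism H (Suc n) f" "idempotent H (Suc n) f" for n f
    using that
  proof (induction n arbitrary: f)
    case 0
    have "f x = x 0" if x: "x \<in> tuples H (Suc 0)" for x
    proof -
      have "x = (\<lambda>i\<in>{..<Suc 0}. x 0)"
        using PiE_arb[OF x] by (auto simp: fun_eq_iff)
      then have "f x = f (\<lambda>i\<in>{..<Suc 0}. x 0)"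
        by (rule arg_cong)
      also have "\<dots> = x 0"
        using 0(2) PiE_mem[OF x, of 0] unfolding idempotent_def by simp
      finally show ?thesis .
    qed
    then show ?case unfolding is_projection_iff by (intro exI[of _ 0]) simp
  next
    case (Suc n)
    note f = Suc.prems
    show ?case
    proof (cases n)
      case 0
      define pr where "pr s t = (\<lambda>i\<in>{..<2::nat}. if i = 0 then s else t)" for s t :: 'a
      define g where "g s t = f (pr s t)" for s t
      have pr: "pr s t \<in> tuples H 2" if "s \<in> pverts H" "t \<in> pverts H" for s t
        using that unfolding pr_def by auto
      have f2: "polymorphism H 2 f" "idempotent H 2 f"
        using f 0 by (simp_all add: numeral_2_eq_2)
      have "(g s t, g s' t') \<in> parcs H" if "(s, s') \<in> parcs H" "(t, t') \<in> parcs H" for s t s' t'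
        unfolding g_def using that arc_vertsD
        by (intro polymorphism_arc[OF f2(1)] pr) (auto simp: pr_def)
      moreover have "g s s = s" if "s \<in> pverts H" for s
        using f2(2) that unfolding g_def pr_def idempotent_def by simp
      ultimately consider "\<forall>s\<in>pverts H. \<forall>t\<in>pverts H. g s t = s"
        | "\<forall>s\<in>pverts H. \<forall>t\<in>pverts H. g s t = t"
        using binary_projection[of g, OF settled] by blast
      moreover have "f x = g (x 0) (x 1) \<and> x 0 \<in> pverts H \<and> x 1 \<in> pverts H"
        if x: "x \<in> tuples H 2" for x
      proof -
        have "pr (x 0) (x 1) = x"
          using PiE_arb[OF x] unfolding pr_def by (auto simp: fun_eq_iff less_2_cases_iff)
        then show ?thesis
          using PiE_mem[OF x] unfolding g_def by simp
      qed
      ultimately have "is_projection H 2 f"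
        unfolding is_projection_iff
        by cases (simp add: exI[of _ "0::nat"], simp add: exI[of _ "1::nat"])
      then show ?thesis using 0 by (simp add: numeral_2_eq_2)
    next
      case (Suc k)
      let ?m = "Suc (Suc n)"
      have minor: "\<exists>p<?m. \<forall>x\<in>tuples H ?m. x i = x j \<longrightarrow> f x = x p" if "i < j" "j < ?m" for i j
        using projection_of_minor[OF f that] Suc.IH by blast
      show ?thesis
      proof (cases "\<exists>i j p. i < j \<and> j < ?m \<and> p < ?m \<and> p \<noteq> i \<and> p \<noteq> j \<and>
          (\<forall>x\<in>tuples H ?m. x i = x j \<longrightarrow> f x = x p)")
        case True
        then obtain i j p where ijp: "i < j" "j < ?m" "p < ?m" "p \<noteq> i" "p \<noteq> j"
          "\<And>x. x \<in> tuples H ?m \<Longrightarrow> x i = x j \<Longrightarrow> f x = x p"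
          by blast
        then have "f x = x p" if "x \<in> tuples H ?m" for x
          using semiprojection_is_projection[OF f(1), of i j p] three that by simp
        then show ?thesis
          unfolding is_projection_iff using ijp(3) by (intro exI[of _ p]) simp
      next
        case False
        have majority: "f x = x i"
          if ij: "i < j" "j < ?m" and x: "x \<in> tuples H ?m" "x i = x j" for i j x
        proof -
          obtain p where p: "p < ?m" "\<forall>x\<in>tuples H ?m. x i = x j \<longrightarrow> f x = x p"
            using minor[OF ij] by blast
          then have "p = i \<or> p = j"
            using False ij by blast
          then show ?thesis
            using p(2) x by auto
        qed
        \<comment> \<open>Beyond arity three, \<open>c\<close> also fills the remaining coordinates;
          the argument inspects only 0, 1 and 2.\<close>
        define x where "x = (\<lambda>i\<in>{..<?m}. if i = 0 then a else if i = 1 then b else c)"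
        have x: "x \<in> tuples H ?m"
          unfolding x_def using verts by auto
        have m: "2 < ?m" using \<open>n = Suc k\<close> by simp
        \<comment> \<open>A neighbouring tuple with \<open>z\<close> at both \<open>i\<close> and
          \<open>j\<close> has value \<open>z\<close> by \<open>majority\<close>. The index
          \<open>p\<close> occupies the third slot of \<open>adjacent_tuple\<close>.\<close>
        have near: "(f x, z) \<in> parcs H"
          if ij: "i < j" "j < ?m" and p: "p < ?m" "p \<noteq> i" "p \<noteq> j"
            and z: "(x i, z) \<in> parcs H" "(x j, z) \<in> parcs H" for i j p z
        proof -
          obtain z' where z': "(x p, z') \<in> parcs H"
            using nbr_exists PiE_mem[OF x, of p] p(1) by blast
          obtain y where y: "y \<in> tuples H ?m" "\<And>k. k < ?m \<Longrightarrow> (x k, y k) \<in> parcs H"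
            "y i = z" "y j = z"
            using adjacent_tuple[OF x _ ij(2) p(1-3) _ z z'] ij by force
          then show ?thesis
            using polymorphism_arc[OF f(1) x y(1)] majority[OF ij y(1)] by simp
        qed
        have "x 0 = a" "x 1 = b" "x 2 = c"
          using m unfolding x_def by simp_all
        then have "(f x, u) \<in> parcs H" "(f x, v) \<in> parcs H" "(f x, w) \<in> parcs H"
          using near[of 0 1 2 u] near[of 0 2 1 v] near[of 1 2 0 w] ab ac bc m by simp_all
        with no_median show ?thesis by blast
      qed
    qed
  qed
  then have "is_projection H m f" if "m \<ge> 1" "polymorphism H m f" "idempotent H m f" for m f
    using that by (cases m) simp_all
  then show ?thesis
    unfolding projective_def by simp
qed

end

section \<open>The Groetzsch graph\<close>

text \<open>A labelling in cyclic order by variables, so that a refutation computed once applies to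
  all ten symmetric copies.\<close>

definition pentagon :: "nat \<Rightarrow> nat \<Rightarrow> nat \<Rightarrow> nat \<Rightarrow> nat \<Rightarrow> bool" where
  "pentagon v0 v1 v2 v3 v4 \<longleftrightarrow> distinct [v0, v1, v2, v3, v4] \<and>
     pverts (cycle_graph 5) = {v0, v1, v2, v3, v4} \<and>
     parcs (cycle_graph 5) = {(v0, v1), (v1, v2), (v2, v3), (v3, v4), (v4, v0),
                              (v1, v0), (v2, v1), (v3, v2), (v4, v3), (v0, v4)}"

lemma pentagon_rotate: "pentagon v0 v1 v2 v3 v4 \<Longrightarrow> pentagon v1 v2 v3 v4 v0"
  unfolding pentagon_def by auto

lemma pentagon_reflect: "pentagon v0 v1 v2 v3 v4 \<Longrightarrow> pentagon v0 v4 v3 v2 v1"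
  unfolding pentagon_def by auto

text \<open>The nontrivial elements of the dihedral group: items 1 to 4 are rotations, items 5 to 9
  the reversed labellings starting at \<open>v0\<close> to \<open>v4\<close> in turn.\<close>

lemma pentagon_symmetries:
  assumes "pentagon v0 v1 v2 v3 v4"
  shows "pentagon v1 v2 v3 v4 v0" "pentagon v2 v3 v4 v0 v1" "pentagon v3 v4 v0 v1 v2"
    "pentagon v4 v0 v1 v2 v3" "pentagon v0 v4 v3 v2 v1" "pentagon v1 v0 v4 v3 v2"
    "pentagon v2 v1 v0 v4 v3" "pentagon v3 v2 v1 v0 v4" "pentagon v4 v3 v2 v1 v0"
proof -
  show P1: "pentagon v1 v2 v3 v4 v0" by (rule pentagon_rotate[OF assms])
  show P2: "pentagon v2 v3 v4 v0 v1" by (rule pentagon_rotate[OF P1])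
  show P3: "pentagon v3 v4 v0 v1 v2" by (rule pentagon_rotate[OF P2])
  show P4: "pentagon v4 v0 v1 v2 v3" by (rule pentagon_rotate[OF P3])
  show "pentagon v0 v4 v3 v2 v1" "pentagon v1 v0 v4 v3 v2" "pentagon v2 v1 v0 v4 v3"
    "pentagon v3 v2 v1 v0 v4" "pentagon v4 v3 v2 v1 v0"
    by (fact assms[THEN pentagon_reflect] P1[THEN pentagon_reflect] P2[THEN pentagon_reflect]
        P3[THEN pentagon_reflect] P4[THEN pentagon_reflect])+
qed

lemma pentagon_01234: "pentagon 0 1 2 3 4"
proof -
  have arcs: "i < 5 \<and> j < 5 \<and> (j = Suc i mod 5 \<or> i = Suc j mod 5) \<longleftrightarrow>
      (i, j) \<in> {(0, 1), (1, 2), (2, 3), (3, 4), (4, 0), (1, 0), (2, 1), (3, 2), (4, 3), (0, 4)}"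
    (is "?L \<longleftrightarrow> ?R") for i j :: nat
  proof
    assume ?L
    then have "i = 0 \<or> i = 1 \<or> i = 2 \<or> i = 3 \<or> i = 4" "j = 0 \<or> j = 1 \<or> j = 2 \<or> j = 3 \<or> j = 4"
      by auto
    with \<open>?L\<close> show ?R by (elim disjE) simp_all
  qed auto
  have "parcs (cycle_graph 5) =
      {(0, 1), (1, 2), (2, 3), (3, 4), (4, 0), (1, 0), (2, 1), (3, 2), (4, 3), (0, 4)}"
    unfolding cycle_graph_def arcs by auto
  moreover have "pverts (cycle_graph 5) = {0, 1, 2, 3, 4}"
    unfolding cycle_graph_def by auto
  ultimately show ?thesis
    unfolding pentagon_def by simp
qed

lemma pentagon_from:
  assumes "i \<in> pverts (cycle_graph 5)"
  obtains v1 v2 v3 v4 where "pentagon i v1 v2 v3 v4"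
proof -
  have "i \<in> {0, 1, 2, 3, 4}"
    using assms pentagon_01234 unfolding pentagon_def by simp
  then show ?thesis
    using that pentagon_01234 pentagon_symmetries(1-4)[OF pentagon_01234] by blast
qed

lemma pentagon_nbrs:
  assumes "pentagon v0 v1 v2 v3 v4"
  shows "(v0, d) \<in> parcs (cycle_graph 5) \<longleftrightarrow> d = v1 \<or> d = v4"
    "(v1, d) \<in> parcs (cycle_graph 5) \<longleftrightarrow> d = v2 \<or> d = v0"
    "(v2, d) \<in> parcs (cycle_graph 5) \<longleftrightarrow> d = v3 \<or> d = v1"
    "(v3, d) \<in> parcs (cycle_graph 5) \<longleftrightarrow> d = v4 \<or> d = v2"
    "(v4, d) \<in> parcs (cycle_graph 5) \<longleftrightarrow> d = v0 \<or> d = v3"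
    "d \<in> pverts (cycle_graph 5) \<longleftrightarrow> d = v0 \<or> d = v1 \<or> d = v2 \<or> d = v3 \<or> d = v4"
    "distinct [v0, v1, v2, v3, v4]"
proof -
  have A: "distinct [v0, v1, v2, v3, v4]" "pverts (cycle_graph 5) = {v0, v1, v2, v3, v4}"
    "parcs (cycle_graph 5) = {(v0, v1), (v1, v2), (v2, v3), (v3, v4), (v4, v0),
                              (v1, v0), (v2, v1), (v3, v2), (v4, v3), (v0, v4)}"
    using assms unfolding pentagon_def by blast+
  have "v0 \<noteq> v1" "v0 \<noteq> v2" "v0 \<noteq> v3" "v0 \<noteq> v4" "v1 \<noteq> v2" "v1 \<noteq> v3" "v1 \<noteq> v4"
    "v2 \<noteq> v3" "v2 \<noteq> v4" "v3 \<noteq> v4"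
    using A(1) by simp_all
  note neq = this this[symmetric]
  show "(v0, d) \<in> parcs (cycle_graph 5) \<longleftrightarrow> d = v1 \<or> d = v4"
    "(v1, d) \<in> parcs (cycle_graph 5) \<longleftrightarrow> d = v2 \<or> d = v0"
    "(v2, d) \<in> parcs (cycle_graph 5) \<longleftrightarrow> d = v3 \<or> d = v1"
    "(v3, d) \<in> parcs (cycle_graph 5) \<longleftrightarrow> d = v4 \<or> d = v2"
    "(v4, d) \<in> parcs (cycle_graph 5) \<longleftrightarrow> d = v0 \<or> d = v3"
    unfolding A(3) using neq by simp_all
  show "d \<in> pverts (cycle_graph 5) \<longleftrightarrow> d = v0 \<or> d = v1 \<or> d = v2 \<or> d = v3 \<or> d = v4"
    unfolding A(2) by simp
qed (use assms in \<open>simp add: pentagon_def\<close>)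

lemma maximal_triangle_free_cycle_5: "maximal_triangle_free (cycle_graph 5)"
proof (intro maximal_triangle_free.intro maximal_triangle_free_axioms.intro)
  show graph: "pair_graph (cycle_graph 5)" by (rule pair_graph_cycle_graph) simp
  then interpret pair_graph "cycle_graph 5" .
  fix u v w :: nat
  assume uv: "(u, v) \<in> parcs (cycle_graph 5)" and vw: "(v, w) \<in> parcs (cycle_graph 5)"
  have "u \<in> pverts (cycle_graph 5)"
    using uv in_arcsD1 by blast
  then obtain v1 v2 v3 v4 where P: "pentagon u v1 v2 v3 v4"
    using pentagon_from by blast
  have "v = v1 \<or> v = v4"
    using uv pentagon_nbrs(1)[OF P] by blast
  then have "w = v2 \<or> w = u \<or> w = v3"
    using vw pentagon_nbrs(2,5)[OF P] by blast
  then show "(w, u) \<notin> parcs (cycle_graph 5)"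
    using pentagon_nbrs[OF P] by auto
next
  fix u v :: nat
  assume uv: "u \<in> pverts (cycle_graph 5)" "v \<in> pverts (cycle_graph 5)"
  then obtain v1 v2 v3 v4 where P: "pentagon u v1 v2 v3 v4"
    using pentagon_from by blast
  note N = pentagon_nbrs[OF P]
  have v: "v = u \<or> v = v1 \<or> v = v2 \<or> v = v3 \<or> v = v4"
    using uv(2) N(6) by blast
  show "\<exists>w. (u, w) \<in> parcs (cycle_graph 5) \<and> (v, w) \<in> parcs (cycle_graph 5)"
    if "(u, v) \<notin> parcs (cycle_graph 5)"
    using v that N(1-5) by blast
  show "u = v"
    if "\<And>w. (u, w) \<in> parcs (cycle_graph 5) \<Longrightarrow> (v, w) \<in> parcs (cycle_graph 5)"
    using that[of v1] that[of v4] v N by auto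
qed

interpretation grotzsch: maximal_triangle_free grotzsch_graph
  unfolding grotzsch_graph_def
  by (rule maximal_triangle_free_mycielskian[OF maximal_triangle_free_cycle_5])
    (simp add: cycle_graph_def lessThan_empty_iff)

section \<open>Arc consistency in the Groetzsch graph\<close>

lemma grotzsch_verts_cases:
  assumes "pentagon v0 v1 v2 v3 v4" "c \<in> pverts grotzsch_graph"
  shows "c \<in> {Orig v0, Orig v1, Orig v2, Orig v3, Orig v4,
    Shadow v0, Shadow v1, Shadow v2, Shadow v3, Shadow v4, Apex}"
  using assms(2) pentagon_nbrs(6)[OF assms(1)] unfolding grotzsch_graph_def by (cases c) auto

lemma grotzsch_nbrs:
  assumes "pentagon v0 v1 v2 v3 v4"
  shows "(Orig v0, d) \<in> parcs grotzsch_graph \<longleftrightarrow>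
      d = Orig v1 \<or> d = Orig v4 \<or> d = Shadow v1 \<or> d = Shadow v4"
    and "(Shadow v0, d) \<in> parcs grotzsch_graph \<longleftrightarrow> d = Orig v1 \<or> d = Orig v4 \<or> d = Apex"
    and "(Apex, d) \<in> parcs grotzsch_graph \<longleftrightarrow>
      d = Shadow v0 \<or> d = Shadow v1 \<or> d = Shadow v2 \<or> d = Shadow v3 \<or> d = Shadow v4"
  using pentagon_nbrs(1,6)[OF assms] unfolding grotzsch_graph_def by (cases d; auto)+

lemma grotzsch_all_nbrs:
  assumes "pentagon v0 v1 v2 v3 v4"
  shows "(Orig v0, d) \<in> parcs grotzsch_graph \<longleftrightarrow>
      d = Orig v1 \<or> d = Orig v4 \<or> d = Shadow v1 \<or> d = Shadow v4"
    "(Orig v1, d) \<in> parcs grotzsch_graph \<longleftrightarrow>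
      d = Orig v2 \<or> d = Orig v0 \<or> d = Shadow v2 \<or> d = Shadow v0"
    "(Orig v2, d) \<in> parcs grotzsch_graph \<longleftrightarrow>
      d = Orig v3 \<or> d = Orig v1 \<or> d = Shadow v3 \<or> d = Shadow v1"
    "(Orig v3, d) \<in> parcs grotzsch_graph \<longleftrightarrow>
      d = Orig v4 \<or> d = Orig v2 \<or> d = Shadow v4 \<or> d = Shadow v2"
    "(Orig v4, d) \<in> parcs grotzsch_graph \<longleftrightarrow>
      d = Orig v0 \<or> d = Orig v3 \<or> d = Shadow v0 \<or> d = Shadow v3"
    "(Shadow v0, d) \<in> parcs grotzsch_graph \<longleftrightarrow> d = Orig v1 \<or> d = Orig v4 \<or> d = Apex"
    "(Shadow v1, d) \<in> parcs grotzsch_graph \<longleftrightarrow> d = Orig v2 \<or> d = Orig v0 \<or> d = Apex"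
    "(Shadow v2, d) \<in> parcs grotzsch_graph \<longleftrightarrow> d = Orig v3 \<or> d = Orig v1 \<or> d = Apex"
    "(Shadow v3, d) \<in> parcs grotzsch_graph \<longleftrightarrow> d = Orig v4 \<or> d = Orig v2 \<or> d = Apex"
    "(Shadow v4, d) \<in> parcs grotzsch_graph \<longleftrightarrow> d = Orig v0 \<or> d = Orig v3 \<or> d = Apex"
    "(Apex, d) \<in> parcs grotzsch_graph \<longleftrightarrow>
      d = Shadow v0 \<or> d = Shadow v1 \<or> d = Shadow v2 \<or> d = Shadow v3 \<or> d = Shadow v4"
    "distinct [v0, v1, v2, v3, v4]"
proof -
  note P = pentagon_symmetries[OF assms]
  show "(Orig v0, d) \<in> parcs grotzsch_graph \<longleftrightarrow>
      d = Orig v1 \<or> d = Orig v4 \<or> d = Shadow v1 \<or> d = Shadow v4"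
    "(Orig v1, d) \<in> parcs grotzsch_graph \<longleftrightarrow>
      d = Orig v2 \<or> d = Orig v0 \<or> d = Shadow v2 \<or> d = Shadow v0"
    "(Orig v2, d) \<in> parcs grotzsch_graph \<longleftrightarrow>
      d = Orig v3 \<or> d = Orig v1 \<or> d = Shadow v3 \<or> d = Shadow v1"
    "(Orig v3, d) \<in> parcs grotzsch_graph \<longleftrightarrow>
      d = Orig v4 \<or> d = Orig v2 \<or> d = Shadow v4 \<or> d = Shadow v2"
    "(Orig v4, d) \<in> parcs grotzsch_graph \<longleftrightarrow>
      d = Orig v0 \<or> d = Orig v3 \<or> d = Shadow v0 \<or> d = Shadow v3"
    "(Shadow v0, d) \<in> parcs grotzsch_graph \<longleftrightarrow> d = Orig v1 \<or> d = Orig v4 \<or> d = Apex"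
    "(Shadow v1, d) \<in> parcs grotzsch_graph \<longleftrightarrow> d = Orig v2 \<or> d = Orig v0 \<or> d = Apex"
    "(Shadow v2, d) \<in> parcs grotzsch_graph \<longleftrightarrow> d = Orig v3 \<or> d = Orig v1 \<or> d = Apex"
    "(Shadow v3, d) \<in> parcs grotzsch_graph \<longleftrightarrow> d = Orig v4 \<or> d = Orig v2 \<or> d = Apex"
    "(Shadow v4, d) \<in> parcs grotzsch_graph \<longleftrightarrow> d = Orig v0 \<or> d = Orig v3 \<or> d = Apex"
    "(Apex, d) \<in> parcs grotzsch_graph \<longleftrightarrow>
      d = Shadow v0 \<or> d = Shadow v1 \<or> d = Shadow v2 \<or> d = Shadow v3 \<or> d = Shadow v4"
    by (fact grotzsch_nbrs[OF assms] grotzsch_nbrs[OF P(1)] grotzsch_nbrs[OF P(2)]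
        grotzsch_nbrs[OF P(3)] grotzsch_nbrs[OF P(4)])+
  show "distinct [v0, v1, v2, v3, v4]"
    using assms unfolding pentagon_def by blast
qed

text \<open>Each of these pairs has two common neighbours that in turn share nothing but the pair.
  All other derivations start from them.\<close>

lemma grotzsch_settled_tight:
  assumes "pentagon v0 v1 v2 v3 v4"
  shows "settled grotzsch_graph (Orig v0) (Orig v2)"
    and "settled grotzsch_graph (Orig v0) (Shadow v0)"
    and "settled grotzsch_graph (Orig v0) Apex"
    and "settled grotzsch_graph (Shadow v0) (Shadow v2)"
proof -
  note N = grotzsch_all_nbrs[OF assms]
  show "settled grotzsch_graph (Orig v0) (Orig v2)"
    by (rule grotzsch.settled_two_common_nbrs[of _ "Orig v1" _ "Shadow v1"]) (use N in auto)
  show "settled grotzsch_graph (Orig v0) (Shadow v0)"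
    by (rule grotzsch.settled_two_common_nbrs[of _ "Orig v1" _ "Orig v4"]) (use N in auto)
  show "settled grotzsch_graph (Orig v0) Apex"
    by (rule grotzsch.settled_two_common_nbrs[of _ "Shadow v1" _ "Shadow v4"]) (use N in auto)
  show "settled grotzsch_graph (Shadow v0) (Shadow v2)"
    by (rule grotzsch.settled_two_common_nbrs[of _ "Orig v1" _ Apex]) (use N in auto)
qed

text \<open>Stated separately to avoid a circle: \<open>grotzsch_settled_origs\<close> uses these
  two values, while the value \<open>Shadow v3\<close> is refuted only afterwards by means of
  \<open>grotzsch_settled_origs\<close>.\<close>

lemma grotzsch_refuted_shadows:
  assumes P: "pentagon v0 v1 v2 v3 v4" and "c = Shadow v2 \<or> c = Shadow v4"
  shows "refuted grotzsch_graph (Shadow v0) (Shadow v1) c"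
proof -
  note N = grotzsch_all_nbrs[OF P]
  have "settled grotzsch_graph (Orig v4) (Orig v2)"
    by (rule grotzsch_settled_tight(1)[OF pentagon_symmetries(9)[OF P]])
  then show ?thesis
    by (rule grotzsch.refuted_settled) (use N assms(2) in auto)
qed

text \<open>The common neighbour \<open>Orig v1\<close> leaves only \<open>Orig v2\<close> and
  \<open>Shadow v0\<close> to refute. The first falls to the settled pair
  \<open>(Orig v4, Apex)\<close>.\<close>

lemma grotzsch_settled_orig_shadow:
  assumes P: "pentagon v0 v1 v2 v3 v4"
  shows "settled grotzsch_graph (Orig v0) (Shadow v2)"
proof -
  have half: "refuted grotzsch_graph (Orig v0) (Shadow v2) (Orig v2)"
    if P: "pentagon v0 v1 v2 v3 v4" for v0 v1 v2 v3 v4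
  proof -
    note N = grotzsch_all_nbrs[OF P]
    show ?thesis
      by (rule grotzsch.refuted_settled[OF
            grotzsch_settled_tight(3)[OF pentagon_symmetries(4)[OF P]]])
        (use N in auto)
  qed
  note N = grotzsch_all_nbrs[OF P]
  have "refuted grotzsch_graph (Orig v3) (Shadow v1) (Orig v1)"
    by (rule half[OF pentagon_symmetries(8)[OF P]])
  note half' = refuted_swap[OF this]
  have "refuted grotzsch_graph (Orig v0) (Shadow v2) (Shadow v0)"
  \<comment> \<open>\<open>(Shadow v1, Orig v3)\<close> is a swapped mirror image of the pair at
    hand, so \<open>half\<close> covers \<open>d = Orig v1\<close>; the common neighbour
    \<open>Orig v2\<close> excludes the rest.\<close>
  proof (rule refuted.step[of _ "Shadow v1" _ _ "Orig v3"])
    fix d assume "(Shadow v0, d) \<in> parcs grotzsch_graph"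
    then consider "d = Orig v1" | "d = Orig v4 \<or> d = Apex"
      using N by auto
    then show "refuted grotzsch_graph (Shadow v1) (Orig v3) d"
    proof cases
      case 2
      then show ?thesis
        by (intro grotzsch.refuted_common_nbr[of _ "Orig v2"]) (use N in auto)
    qed (use half' in simp)
  qed (use N in auto)
  moreover have "refuted grotzsch_graph (Orig v0) (Shadow v2) c"
    if "(Orig v1, c) \<notin> parcs grotzsch_graph" for c
    by (rule grotzsch.refuted_common_nbr[OF _ _ that]) (use N in auto)
  ultimately show ?thesis
    unfolding settled_def using half[OF P] N(2) by metis
qed

text \<open>The settled pairs \<open>(Orig v4, Orig v2)\<close> and
  \<open>(Shadow v4, Shadow v2)\<close> exclude all values but \<open>Orig v3\<close>, which takes a
  further step through \<open>(Shadow v1, Shadow v0)\<close>.\<close>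

lemma grotzsch_settled_origs:
  assumes P: "pentagon v0 v1 v2 v3 v4"
  shows "settled grotzsch_graph (Orig v0) (Orig v1)"
  unfolding settled_def
proof (intro ballI impI)
  note N = grotzsch_all_nbrs[OF P]
  note P4 = pentagon_symmetries(9)[OF P]
  fix c assume "c \<in> pverts grotzsch_graph" "c \<noteq> Orig v0" "c \<noteq> Orig v1"
  then consider "c \<in> {Orig v2, Orig v4, Shadow v2, Shadow v4, Apex}"
    | "c \<in> {Shadow v0, Shadow v1, Shadow v3}" | "c = Orig v3"
    using grotzsch_verts_cases[OF P] by blast
  then show "refuted grotzsch_graph (Orig v0) (Orig v1) c"
  proof cases
    case 1
    then show ?thesis
      by (intro grotzsch.refuted_settled[OF grotzsch_settled_tight(1)[OF P4]])
        (use N in auto)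
  next
    case 2
    then show ?thesis
      by (intro grotzsch.refuted_settled[OF grotzsch_settled_tight(4)[OF P4]])
        (use N in auto)
  next
    case 3
    show ?thesis
    proof (rule refuted.step[of _ "Shadow v1" _ _ "Shadow v0"])
      fix d assume "(c, d) \<in> parcs grotzsch_graph"
      then consider "d = Shadow v2 \<or> d = Shadow v4" | "d = Orig v2 \<or> d = Orig v4"
        using 3 N by auto
      then show "refuted grotzsch_graph (Shadow v1) (Shadow v0) d"
      proof cases
        case 1
        then show ?thesis by (rule refuted_swap[OF grotzsch_refuted_shadows[OF P]])
      next
        case 2
        then show ?thesis
          by (intro grotzsch.refuted_common_nbr[of _ Apex]) (use N in auto)
      qed
    qed (use N in auto)
  qed
qed

lemma grotzsch_settled_shadows:
  assumes P: "pentagon v0 v1 v2 v3 v4"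
  shows "settled grotzsch_graph (Shadow v0) (Shadow v1)"
  unfolding settled_def
proof (intro ballI impI)
  note N = grotzsch_all_nbrs[OF P]
  fix c assume "c \<in> pverts grotzsch_graph" "c \<noteq> Shadow v0" "c \<noteq> Shadow v1"
  then consider "c = Shadow v2 \<or> c = Shadow v4" | "c = Shadow v3"
    | "(Apex, c) \<notin> parcs grotzsch_graph"
    using N(11)[of c] by blast
  then show "refuted grotzsch_graph (Shadow v0) (Shadow v1) c"
  proof cases
    case 1
    then show ?thesis by (rule grotzsch_refuted_shadows[OF P])
  next
    case 2
    then show ?thesis
      by (intro grotzsch.refuted_settled[OF settled_swap[OF grotzsch_settled_origs[OF P]]])
        (use N in auto)
  next
    case 3
    then show ?thesis
      by (intro grotzsch.refuted_common_nbr[of _ Apex]) (use N in auto)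
  qed
qed

text \<open>The settled pairs \<open>(Orig v4, Orig v2)\<close>, \<open>(Apex, Orig v0)\<close>,
  \<open>(Orig v4, Shadow v2)\<close> and \<open>(Orig v1, Orig v0)\<close> together exclude every
  value.\<close>

lemma grotzsch_settled_shadow_orig:
  assumes P: "pentagon v0 v1 v2 v3 v4"
  shows "settled grotzsch_graph (Shadow v0) (Orig v1)"
  unfolding settled_def
proof (intro ballI impI)
  note N = grotzsch_all_nbrs[OF P]
  note P4 = pentagon_symmetries(9)[OF P]
  fix c assume "c \<in> pverts grotzsch_graph" "c \<noteq> Shadow v0" "c \<noteq> Orig v1"
  then consider "c \<in> {Orig v2, Orig v4, Shadow v2, Shadow v4, Apex}"
    | "c \<in> {Orig v0, Orig v3}" | "c = Shadow v1" | "c = Shadow v3"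
    using grotzsch_verts_cases[OF P] by blast
  then show "refuted grotzsch_graph (Shadow v0) (Orig v1) c"
  proof cases
    case 1
    then show ?thesis
      by (intro grotzsch.refuted_settled[OF grotzsch_settled_tight(1)[OF P4]]) (use N in auto)
  next
    case 2
    then show ?thesis
      by (intro grotzsch.refuted_settled[OF settled_swap[OF grotzsch_settled_tight(3)[OF P]]])
        (use N in auto)
  next
    case 3
    then show ?thesis
      by (intro grotzsch.refuted_settled[OF grotzsch_settled_orig_shadow[OF P4]]) (use N in auto)
  next
    case 4
    then show ?thesis
      by (intro grotzsch.refuted_settled[OF settled_swap[OF grotzsch_settled_origs[OF P]]])
        (use N in auto)
  qed
qed

lemma grotzsch_settled_shadow_apex:
  assumes P: "pentagon v0 v1 v2 v3 v4"
  shows "settled grotzsch_graph (Shadow v0) Apex"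
proof -
  note N = grotzsch_all_nbrs[OF P]
  note P1 = pentagon_symmetries(1)[OF P] and P4 = pentagon_symmetries(4)[OF P]
  have others: "refuted grotzsch_graph (Shadow v0) Apex c"
    if "c \<in> pverts grotzsch_graph" "c \<noteq> Orig v0" "c \<noteq> Shadow v0" "c \<noteq> Apex" for c
  proof -
    from that consider "c \<in> {Orig v2, Orig v1, Orig v4, Shadow v1, Shadow v2, Shadow v4}"
      | "c \<in> {Orig v3, Shadow v3}"
      using grotzsch_verts_cases[OF P] by blast
    then show ?thesis
    proof cases
      case 1
      then show ?thesis
        by (intro grotzsch.refuted_settled[OF grotzsch_settled_tight(2)[OF P4]]) (use N in auto)
    next
      case 2
      then show ?thesis
        by (intro grotzsch.refuted_settled[OF grotzsch_settled_tight(2)[OF P1]]) (use N in auto)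
    qed
  qed
  have "refuted grotzsch_graph (Shadow v0) Apex (Orig v0)"
  \<comment> \<open>The step leads back to the same pair in reverse order, where
    \<open>others\<close> already excludes all neighbours of \<open>Orig v0\<close>.\<close>
  proof (rule refuted.step[of _ Apex _ _ "Shadow v0"])
    fix d assume d: "(Orig v0, d) \<in> parcs grotzsch_graph"
    then have "d \<noteq> Orig v0" "d \<noteq> Shadow v0" "d \<noteq> Apex"
      using N by auto
    then show "refuted grotzsch_graph Apex (Shadow v0) d"
      using grotzsch.arc_vertsD[OF d] by (intro refuted_swap[OF others]) simp_all
  qed (use N in auto)
  with others show ?thesis
    unfolding settled_def by blast
qed

lemma grotzsch_settled:
  assumes "a \<in> pverts grotzsch_graph" "b \<in> pverts grotzsch_graph"
  shows "settled grotzsch_graph a b"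
proof -
  have index: "i \<in> pverts (cycle_graph 5)"
    if "Orig i \<in> pverts grotzsch_graph \<or> Shadow i \<in> pverts grotzsch_graph" for i
    using that unfolding grotzsch_graph_def by simp
  have orig: "settled grotzsch_graph (Orig i) c"
    if i: "Orig i \<in> pverts grotzsch_graph" and c: "c \<in> pverts grotzsch_graph" for i c
  proof -
    obtain v1 v2 v3 v4 where P: "pentagon i v1 v2 v3 v4"
      using pentagon_from index i by blast
    \<comment> \<open>\<open>P'\<close> reaches the indices on the other side of \<open>i\<close>;
      \<open>P1\<close> and \<open>P4\<close> start at the two neighbours of \<open>i\<close>, which
      puts \<open>Orig i\<close> in second place.\<close>
    note P' = pentagon_symmetries(5)[OF P]
      and P1 = pentagon_symmetries(6)[OF P] and P4 = pentagon_symmetries(4)[OF P]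
    show ?thesis
      using grotzsch_verts_cases[OF P c] settled_refl
        grotzsch_settled_tight[OF P] grotzsch_settled_tight[OF P']
        grotzsch_settled_origs[OF P] grotzsch_settled_origs[OF P']
        grotzsch_settled_orig_shadow[OF P] grotzsch_settled_orig_shadow[OF P']
        settled_swap[OF grotzsch_settled_shadow_orig[OF P1]]
        settled_swap[OF grotzsch_settled_shadow_orig[OF P4]]
      by auto
  qed
  have shadow: "settled grotzsch_graph (Shadow i) c"
    if i: "Shadow i \<in> pverts grotzsch_graph" and c: "c \<in> pverts grotzsch_graph" for i c
  proof (cases c)
    case (Orig j)
    then show ?thesis using settled_swap[OF orig[of j, OF _ i]] c by simp
  next
    case (Shadow j)
    obtain v1 v2 v3 v4 where P: "pentagon i v1 v2 v3 v4"
      using pentagon_from index i by blast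
    note P' = pentagon_symmetries(5)[OF P]
    show ?thesis
      using grotzsch_verts_cases[OF P c] settled_refl Shadow
        grotzsch_settled_tight(4)[OF P] grotzsch_settled_tight(4)[OF P']
        grotzsch_settled_shadows[OF P] grotzsch_settled_shadows[OF P']
      by auto
  next
    case Apex
    obtain v1 v2 v3 v4 where "pentagon i v1 v2 v3 v4"
      using pentagon_from index i by blast
    with Apex show ?thesis using grotzsch_settled_shadow_apex by blast
  qed
  show ?thesis
  proof (cases a)
    case Apex
    show ?thesis
    proof (cases b)
      case (Orig j)
      then show ?thesis using settled_swap[OF orig[of j, OF _ assms(1)]] assms(2) by simp
    next
      case (Shadow j)
      then show ?thesis using settled_swap[OF shadow[of j, OF _ assms(1)]] assms(2) by simp
    qed (use Apex settled_refl in simp)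
  qed (use orig shadow assms in auto)
qed

lemma projective_grotzsch: "projective grotzsch_graph"
proof -
  note N = grotzsch_all_nbrs[OF pentagon_01234]
  \<comment> \<open>The only common neighbour of \<open>Shadow 4\<close> and \<open>Shadow 3\<close>
    is \<open>Apex\<close>, which is not adjacent to \<open>Orig 1\<close>.\<close>
  show ?thesis
    by (rule grotzsch.projective[where a = "Orig 0" and b = "Orig 2" and c = Apex
          and u = "Orig 1" and v = "Shadow 4" and w = "Shadow 3", OF grotzsch_settled])
      (use N in auto)
qed

section \<open>The Petersen graph\<close>

lemma petersen_arc_iff:
  "(A, B) \<in> parcs petersen_graph \<longleftrightarrow>
     A \<in> pverts petersen_graph \<and> B \<in> pverts petersen_graph \<and> A \<inter> B = {}"
  unfolding petersen_graph_def kneser_graph_def by auto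

lemma petersen_vertD:
  assumes "A \<in> pverts petersen_graph"
  shows "A \<subseteq> {..<5}" "card A = 2" "finite A"
  using assms finite_subset[of A "{..<5}"] unfolding petersen_graph_def kneser_graph_def by auto

text \<open>Three disjoint pairs would need six points; two intersecting pairs leave at least two
  points free; and for \<open>b\<close> in \<open>B\<close> but not in \<open>A\<close>, a pair
  \<open>{b, e}\<close> outside \<open>A\<close> still meets \<open>B\<close>.\<close>

interpretation petersen: maximal_triangle_free petersen_graph
proof (intro maximal_triangle_free.intro maximal_triangle_free_axioms.intro)
  show "pair_graph petersen_graph" by (rule pair_graph_petersen_graph)
next
  fix A B C
  assume AB: "(A, B) \<in> parcs petersen_graph" and BC: "(B, C) \<in> parcs petersen_graph"
  show "(C, A) \<notin> parcs petersen_graph"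
  proof
    assume CA: "(C, A) \<in> parcs petersen_graph"
    note V = petersen_vertD[of A] petersen_vertD[of B] petersen_vertD[of C]
    have "card (A \<union> B \<union> C) = card A + card B + card C"
      using AB BC CA V unfolding petersen_arc_iff
      by (subst card_Un_disjoint, simp, simp, blast)+ simp
    moreover have "card (A \<union> B \<union> C) \<le> card {..<5::nat}"
      using AB BC V unfolding petersen_arc_iff by (intro card_mono) auto
    ultimately show False
      using AB BC V unfolding petersen_arc_iff by simp
  qed
next
  fix A B
  assume A: "A \<in> pverts petersen_graph" and B: "B \<in> pverts petersen_graph"
  note V = petersen_vertD[OF A] petersen_vertD[OF B]
  show "\<exists>C. (A, C) \<in> parcs petersen_graph \<and> (B, C) \<in> parcs petersen_graph"
    if "(A, B) \<notin> parcs petersen_graph"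
  proof -
    have "A \<inter> B \<noteq> {}"
      using that A B unfolding petersen_arc_iff by blast
    then have "card (A \<inter> B) > 0"
      using V by (simp add: card_gt_0_iff)
    then have "card (A \<union> B) \<le> 3"
      using card_Un_Int[of A B] V by simp
    then have "card ({..<5} - (A \<union> B)) \<ge> 2"
      using V by (simp add: card_Diff_subset)
    then obtain C where "C \<subseteq> {..<5} - (A \<union> B)" "card C = 2"
      by (meson obtain_subset_with_card_n)
    then have "C \<in> pverts petersen_graph" "A \<inter> C = {}" "B \<inter> C = {}"
      unfolding petersen_graph_def kneser_graph_def by auto
    then show ?thesis
      using A B unfolding petersen_arc_iff by blast
  qed
  show "A = B"
    if sub: "\<And>C. (A, C) \<in> parcs petersen_graph \<Longrightarrow> (B, C) \<in> parcs petersen_graph"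
  proof (rule ccontr)
    assume "A \<noteq> B"
    then obtain b where b: "b \<in> B" "b \<notin> A"
      using card_subset_eq[of A B] V by auto
    have "card ({..<5} - insert b A) = 2"
      using V b by (subst card_Diff_subset) auto
    then obtain e where e: "e < 5" "e \<noteq> b" "e \<notin> A"
      by (metis Diff_iff card.empty equals0I insertCI lessThan_iff zero_neq_numeral)
    have "(A, {b, e}) \<in> parcs petersen_graph"
      using A V b e unfolding petersen_graph_def kneser_graph_def by auto
    then have "(B, {b, e}) \<in> parcs petersen_graph"
      by (rule sub)
    with b show False unfolding petersen_arc_iff by blast
  qed
qed

text \<open>Variable names for the five points make the action of the symmetric group a mere
  renaming.\<close>

definition enum5 :: "nat \<Rightarrow> nat \<Rightarrow> nat \<Rightarrow> nat \<Rightarrow> nat \<Rightarrow> bool" where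
  "enum5 x y z v w \<longleftrightarrow> distinct [x, y, z, v, w] \<and> {..<5} = {x, y, z, v, w}"

lemma petersen_verts_cases:
  assumes "enum5 x y z v w" "A \<in> pverts petersen_graph"
  shows "A \<in> {{x, y}, {x, z}, {x, v}, {x, w}, {y, z}, {y, v}, {y, w}, {z, v}, {z, w}, {v, w}}"
proof -
  obtain s t where "A = {s, t}" "s \<noteq> t"
    using petersen_vertD(2)[OF assms(2)] by (auto simp: card_2_iff)
  moreover from this have "s \<in> {x, y, z, v, w}" "t \<in> {x, y, z, v, w}"
    using petersen_vertD(1)[OF assms(2)] assms(1) unfolding enum5_def by auto
  ultimately show ?thesis
    by (elim insertE emptyE) (simp_all add: doubleton_eq_iff)
qed

lemma petersen_vert: "s < 5 \<Longrightarrow> t < 5 \<Longrightarrow> s \<noteq> t \<Longrightarrow> {s, t} \<in> pverts petersen_graph"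
  unfolding petersen_graph_def kneser_graph_def by auto

lemma enum5D:
  assumes "enum5 x y z v w"
  shows "x < 5" "y < 5" "z < 5" "v < 5" "w < 5" "distinct [x, y, z, v, w]"
  using assms unfolding enum5_def by auto

text \<open>The common neighbour \<open>{v, w}\<close> excludes all values but
  \<open>{y, z}\<close>. The neighbours of \<open>{y, z}\<close> all meet \<open>{x, w}\<close>, the
  common neighbour of \<open>{z, v}\<close> and \<open>{y, v}\<close>.\<close>

lemma petersen_settled_nonadjacent:
  assumes e: "enum5 x y z v w"
  shows "settled petersen_graph {x, y} {x, z}"
  unfolding settled_def
proof (intro ballI impI)
  note d = enum5D[OF e]
  fix c assume c: "c \<in> pverts petersen_graph" "c \<noteq> {x, y}" "c \<noteq> {x, z}"
  show "refuted petersen_graph {x, y} {x, z} c"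
  proof (cases "c = {y, z}")
    case True
    show ?thesis
    proof (rule refuted.step[of _ "{z, v}" _ _ "{y, v}"])
      fix d assume "(c, d) \<in> parcs petersen_graph"
      then have "d \<in> {{x, v}, {x, w}, {v, w}}"
        using petersen_verts_cases[OF e, of d] True unfolding petersen_arc_iff by auto
      then have "({x, w}, d) \<notin> parcs petersen_graph"
        unfolding petersen_arc_iff by auto
      then show "refuted petersen_graph {z, v} {y, v} d"
        by (rule petersen.refuted_common_nbr[rotated 2])
          (use d in \<open>auto simp: petersen_arc_iff petersen_vert\<close>)
    qed (use d in \<open>auto simp: petersen_arc_iff petersen_vert\<close>)
  next
    case False
    then have "({v, w}, c) \<notin> parcs petersen_graph"
      using petersen_verts_cases[OF e c(1)] c(2,3) unfolding petersen_arc_iff by auto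
    then show ?thesis
      by (rule petersen.refuted_common_nbr[rotated 2])
        (use d in \<open>auto simp: petersen_arc_iff petersen_vert\<close>)
  qed
qed

text \<open>Through \<open>w\<close> the arc leads to the settled pairs \<open>{s, w}\<close>,
  \<open>{t, w}\<close>. Any other vertex contains \<open>w\<close> or one point from each of
  \<open>{x, y}\<close> and \<open>{z, v}\<close>, hence meets both for some choice of
  \<open>s\<close> and \<open>t\<close>.\<close>

lemma petersen_settled_adjacent:
  assumes e: "enum5 x y z v w"
  shows "settled petersen_graph {x, y} {z, v}"
  unfolding settled_def
proof (intro ballI impI)
  note d = enum5D[OF e]
  fix c assume c: "c \<in> pverts petersen_graph" "c \<noteq> {x, y}" "c \<noteq> {z, v}"
  have via: "refuted petersen_graph {x, y} {z, v} c"
    if "s \<in> {z, v}" "t \<in> {x, y}" "c \<inter> {s, w} \<noteq> {}" "c \<inter> {t, w} \<noteq> {}" for s t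
  proof -
    have "enum5 w s t (if s = z then v else z) (if t = x then y else x)"
      using that(1,2) e unfolding enum5_def by auto
    then have "settled petersen_graph {s, w} {t, w}"
      using petersen_settled_nonadjacent[of w s t] by (simp add: insert_commute)
    then show ?thesis
      by (rule petersen.refuted_settled)
        (use that d in \<open>auto simp: petersen_arc_iff petersen_vert\<close>)
  qed
  have "\<exists>s\<in>{z, v}. \<exists>t\<in>{x, y}. c \<inter> {s, w} \<noteq> {} \<and> c \<inter> {t, w} \<noteq> {}"
    using petersen_verts_cases[OF e c(1)] c(2,3) by auto
  then show "refuted petersen_graph {x, y} {z, v} c"
    using via by blast
qed

lemma petersen_settled:
  assumes "A \<in> pverts petersen_graph" "B \<in> pverts petersen_graph"
  shows "settled petersen_graph A B"
proof -
  obtain x y where A: "A = {x, y}" "x \<noteq> y"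
    using petersen_vertD(2)[OF assms(1)] by (auto simp: card_2_iff)
  then have "card ({..<5} - {x, y}) = 3"
    using petersen_vertD[OF assms(1)] by (subst card_Diff_subset) auto
  then obtain z v w where "{..<5} - {x, y} = {z, v, w}" "z \<noteq> v" "v \<noteq> w" "z \<noteq> w"
    by (auto simp: card_3_iff)
  then have e: "enum5 x y z v w"
    using A petersen_vertD(1)[OF assms(1)] unfolding enum5_def by auto
  \<comment> \<open>\<open>e\<close> and items 1 to 5 give the six vertices meeting \<open>A\<close>
    in one point; \<open>e\<close> and items 6, 7 the three disjoint from \<open>A\<close>.\<close>
  have perm: "enum5 x y v z w" "enum5 x y w z v" "enum5 y x z v w" "enum5 y x v z w"
    "enum5 y x w z v" "enum5 x y z w v" "enum5 x y v w z"
    using e unfolding enum5_def by auto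
  have "{y, x} = {x, y}"
    by auto
  then show ?thesis
    using petersen_verts_cases[OF e assms(2)] A settled_refl
      petersen_settled_nonadjacent[OF e] petersen_settled_nonadjacent[OF perm(1)]
      petersen_settled_nonadjacent[OF perm(2)] petersen_settled_nonadjacent[OF perm(3)]
      petersen_settled_nonadjacent[OF perm(4)] petersen_settled_nonadjacent[OF perm(5)]
      petersen_settled_adjacent[OF e] petersen_settled_adjacent[OF perm(6)]
      petersen_settled_adjacent[OF perm(7)]
    by auto
qed

lemma projective_petersen: "projective petersen_graph"
proof -
  have "enum5 0 1 2 3 4"
    unfolding enum5_def by auto
  note cases = petersen_verts_cases[OF this]
  \<comment> \<open>The sets chosen for \<open>u\<close>, \<open>v\<close>, \<open>w\<close> cover 1
    to 4, so only the point 0 remains for a common neighbour.\<close>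
  show ?thesis
    by (rule petersen.projective[where a = "{0, 1}" and b = "{0, 2}" and c = "{0, 3}"
          and u = "{3, 4}" and v = "{2, 4}" and w = "{1, 4}", OF petersen_settled])
      (use cases in \<open>auto simp: petersen_arc_iff petersen_vert\<close>)
qed

theorem theorem4p5:
  shows "(is_core grotzsch_graph \<and> projective grotzsch_graph) \<and>
         (is_core petersen_graph \<and> projective petersen_graph)"
  using grotzsch.is_core projective_grotzsch petersen.is_core projective_petersen by blast

end
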